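(* Let $\Gamma$ be the Berlekamp–Van Lint–Seidel graph, i.e. the Cayley graph $\mathrm{Cay}(V(5,3),S_2)$ with $S_2=\{\pm x_1,\dots,\pm x_{11}\}$, where $x_1=(1,1,1,1,1)$, $x_2=(1,1,2,2,0)$, $x_3=(1,2,1,0,2)$, $x_4=(2,1,0,1,2)$, $x_5=(2,0,1,2,1)$, $x_6=(0,2,2,1,1)$, and $x_7,\dots,x_{11}$ are the standard basis vectors $(1,0,0,0,0),\dots,(0,0,0,0,1)$ of $V(5,3)$. Then: (1) $\Gamma$ has no automorphism of order $2$ that interchanges only adjacent vertices; (2) up to conjugation in the automorphism group of $\Gamma$, there is exactly one automorphism of order $2$ of $\Gamma$ that interchanges only non-adjacent vertices.
   Context: $V(5,3)$ is the $5$-dimensional vector space of row vectors over $\mathbb{F}_3$. For a group $G$ and an inverse-closed subset $S\subseteq G$ not containing the identity, the Cayley graph $\mathrm{Cay}(G,S)$ has vertex set $G$, with $x,y$ adjacent iff $xy^{-1}\in S$ (here, iff $x-y\in S$). The vectors $x_1,\dots,x_{11}$ are the columns of the parity-check matrix of the ternary Golay code; $\Gamma$ is strongly regular with parameters $(243,22,1,2)$. An automorphism $\phi$ of order $2$ "interchanges only adjacent vertices" if for every vertex $u$ with $\phi(u)\neq u$, the vertices $u$ and $\phi(u)$ are adjacent; it "interchanges only non-adjacent vertices" if for every vertex $u$ with $\phi(u)\neq u$, the vertices $u$ and $\phi(u)$ are non-adjacent. *)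

theory Defs
  imports
    "HOL-Analysis.Cartesian_Space"
    "HOL-Library.Numeral_Type"
    "HOL-Algebra.Bij"
    "HOL-Algebra.Multiplicative_Group"
begin

text \<open>A simple graph whose vertex set is a whole type is given by its adjacency relation.
  Cayley graphs are formed in additively written groups, so $xy^{-1}$ reads $x - y$.\<close>

definition cayley_adj :: "'a::group_add set \<Rightarrow> 'a \<Rightarrow> 'a \<Rightarrow> bool" where
  "cayley_adj S x y \<longleftrightarrow> x - y \<in> S"

definition aut_group :: "('a \<Rightarrow> 'a \<Rightarrow> bool) \<Rightarrow> ('a \<Rightarrow> 'a) monoid" where
  "aut_group adj =
     (BijGroup UNIV)\<lparr>carrier := {f \<in> Bij UNIV. \<forall>u v. adj (f u) (f v) \<longleftrightarrow> adj u v}\<rparr>"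

lemma mem_aut_group_iff:
  "f \<in> carrier (aut_group adj) \<longleftrightarrow> bij f \<and> (\<forall>u v. adj (f u) (f v) \<longleftrightarrow> adj u v)"
  by (simp add: aut_group_def Bij_def)

lemma one_aut_group: "\<one>\<^bsub>aut_group adj\<^esub> = id"
  by (simp add: aut_group_def BijGroup_def fun_eq_iff)

lemma mult_aut_group:
  "f \<in> carrier (aut_group adj) \<Longrightarrow> g \<in> carrier (aut_group adj)
    \<Longrightarrow> f \<otimes>\<^bsub>aut_group adj\<^esub> g = f \<circ> g"
  by (simp add: aut_group_def BijGroup_def compose_def fun_eq_iff)

lemma group_aut_group: "group (aut_group adj)"
proof (rule groupI)
  fix f g assume *: "f \<in> carrier (aut_group adj)" "g \<in> carrier (aut_group adj)"
  then show fg: "f \<otimes>\<^bsub>aut_group adj\<^esub> g \<in> carrier (aut_group adj)"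
    unfolding mult_aut_group[OF *] by (simp add: mem_aut_group_iff bij_comp)
  fix h assume h: "h \<in> carrier (aut_group adj)"
  have gh: "g \<circ> h \<in> carrier (aut_group adj)"
    using * h by (simp add: mem_aut_group_iff bij_comp)
  show "f \<otimes>\<^bsub>aut_group adj\<^esub> g \<otimes>\<^bsub>aut_group adj\<^esub> h
      = f \<otimes>\<^bsub>aut_group adj\<^esub> (g \<otimes>\<^bsub>aut_group adj\<^esub> h)"
    using mult_aut_group[OF fg h] mult_aut_group[OF *] mult_aut_group[OF *(2) h]
      mult_aut_group[OF *(1) gh]
    by (simp add: comp_assoc)
next
  show one: "\<one>\<^bsub>aut_group adj\<^esub> \<in> carrier (aut_group adj)"
    by (simp add: one_aut_group mem_aut_group_iff)
  fix f assume f: "f \<in> carrier (aut_group adj)"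
  show "\<one>\<^bsub>aut_group adj\<^esub> \<otimes>\<^bsub>aut_group adj\<^esub> f = f"
    unfolding mult_aut_group[OF one f] by (simp add: one_aut_group)
  have surj: "f (inv_into UNIV f u) = u" for u
    using f by (simp add: mem_aut_group_iff bij_is_surj surj_f_inv_f)
  have "adj (inv_into UNIV f u) (inv_into UNIV f v) \<longleftrightarrow> adj u v" for u v
    using f surj by (metis mem_aut_group_iff)
  then have i: "inv_into UNIV f \<in> carrier (aut_group adj)"
    using f by (simp add: mem_aut_group_iff bij_imp_bij_inv)
  have "inv_into UNIV f \<circ> f = id"
    using f by (simp add: mem_aut_group_iff bij_is_inj)
  then show "\<exists>g\<in>carrier (aut_group adj). g \<otimes>\<^bsub>aut_group adj\<^esub> f = \<one>\<^bsub>aut_group adj\<^esub>"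
    using i mult_aut_group[OF i f] by (auto simp: one_aut_group)
qed

definition interchanges_only_adjacent :: "('a \<Rightarrow> 'a \<Rightarrow> bool) \<Rightarrow> ('a \<Rightarrow> 'a) \<Rightarrow> bool" where
  "interchanges_only_adjacent adj f \<longleftrightarrow> (\<forall>u. f u \<noteq> u \<longrightarrow> adj u (f u))"

definition interchanges_only_nonadjacent :: "('a \<Rightarrow> 'a \<Rightarrow> bool) \<Rightarrow> ('a \<Rightarrow> 'a) \<Rightarrow> bool" where
  "interchanges_only_nonadjacent adj f \<longleftrightarrow> (\<forall>u. f u \<noteq> u \<longrightarrow> \<not> adj u (f u))"

definition conjugate_in :: "('a, 'b) monoid_scheme \<Rightarrow> 'a \<Rightarrow> 'a \<Rightarrow> bool" where
  "conjugate_in G x y \<longleftrightarrow> (\<exists>g\<in>carrier G. y = g \<otimes>\<^bsub>G\<^esub> x \<otimes>\<^bsub>G\<^esub> inv\<^bsub>G\<^esub> g)"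

text \<open>The type \<^typ>\<open>3\<close> carries arithmetic modulo 3 and so serves as $\mathbb{F}_3$.
  The indices of \<^typ>\<open>3 ^ 5\<close> are the residues $1, 2, 3, 4, 5 = 0$ modulo 5, and
  \<^const>\<open>vector\<close> fills the coordinates in this order, as shown next.\<close>

lemma vector_5:
  fixes a b c d e :: "'a::zero"
  shows "(vector [a, b, c, d, e] :: 'a ^ 5) $ 1 = a"
    and "(vector [a, b, c, d, e] :: 'a ^ 5) $ 2 = b"
    and "(vector [a, b, c, d, e] :: 'a ^ 5) $ 3 = c"
    and "(vector [a, b, c, d, e] :: 'a ^ 5) $ 4 = d"
    and "(vector [a, b, c, d, e] :: 'a ^ 5) $ 5 = e"
  by (simp_all add: vector_def)

definition BLS_vectors :: "(3 ^ 5) set" where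
  "BLS_vectors =
     {vector [1, 1, 1, 1, 1],
      vector [1, 1, 2, 2, 0],
      vector [1, 2, 1, 0, 2],
      vector [2, 1, 0, 1, 2],
      vector [2, 0, 1, 2, 1],
      vector [0, 2, 2, 1, 1],
      vector [1, 0, 0, 0, 0],
      vector [0, 1, 0, 0, 0],
      vector [0, 0, 1, 0, 0],
      vector [0, 0, 0, 1, 0],
      vector [0, 0, 0, 0, 1]}"

definition BLS_connection_set :: "(3 ^ 5) set" where
  "BLS_connection_set = BLS_vectors \<union> uminus ` BLS_vectors"

definition BLS_adj :: "3 ^ 5 \<Rightarrow> 3 ^ 5 \<Rightarrow> bool" where
  "BLS_adj = cayley_adj BLS_connection_set"

lemma uminus_BLS_connection_set: "uminus ` BLS_connection_set = BLS_connection_set"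
  by (auto simp: BLS_connection_set_def image_Un image_image)

lemma zero_notin_BLS_connection_set: "0 \<notin> BLS_connection_set"
proof -
  have "v \<noteq> 0" if "v \<in> BLS_vectors" for v
    using that unfolding BLS_vectors_def
    by (elim insertE emptyE; force dest!: arg_cong[where f = "\<lambda>w. (w $ 1, w $ 2, w $ 3, w $ 4, w $ 5)"] simp: vector_5)
  then show ?thesis
    by (force simp: BLS_connection_set_def)
qed

end

theory Submission
  imports Defs
begin

text \<open>
  The linear maps preserving the connection set act on the eleven lines $\{x, -x\}$ as $M_{11}$,
  hence 4-transitively. As $x_1, e_1, e_2, e_3$ are linearly independent, so are any four lines,
  which yields $\lambda = 1$ and $\mu = 2$. These parameters force every automorphism $\varphi$
  fixing $0$ to be additive: the permutation $x \mapsto \varphi(u + x) - \varphi(u)$ of the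
  connection set is the same for adjacent vertices $u$, hence for all $u$.

  If an involution moves $u$ to an adjacent vertex, it fixes the third vertex $w$ of their triangle.
  Around $w$ it is linear, negates one line and, if it interchanges only adjacent vertices, fixes the
  ten others pointwise; but these span the space. An involution interchanging only non-adjacent
  vertices has a fixed point because $243$ is odd. Around that point it is linear and swaps at least
  two pairs of lines, which 4-transitivity moves to $x_1 \leftrightarrow e_1$ and
  $e_2 \leftrightarrow e_3$; only one such map negates no element of the connection set.
\<close>

section \<open>Vectors over the field with three elements\<close>

lemma F3_simps [simp]:
  "(3::3) = 0" "(4::3) = 1" "- (1::3) = 2" "- (2::3) = 1"
  "(1::3) \<noteq> 2" "(2::3) \<noteq> 1" "(0::3) \<noteq> 2" "(2::3) \<noteq> 0"
  by simp_all

text \<open>In characteristic 3 doubling is negation, so sums \<open>v + v\<close> stay in the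
  negation-closed connection set.\<close>

lemma double_F3_vec: fixes v :: "3 ^ 'n" shows "- v - v = v" "v + v = - v"
proof -
  have "- c - c = c" "c + c = - c" for c :: 3
    using exhaust_3[of c] by auto
  then show "- v - v = v" "v + v = - v" by (simp_all add: vec_eq_iff)
qed

lemma exhaust_5:
  fixes x :: 5
  shows "x = 1 \<or> x = 2 \<or> x = 3 \<or> x = 4 \<or> x = 5"
proof (induct x)
  case (of_int z)
  then have "z = 0 \<or> z = 1 \<or> z = 2 \<or> z = 3 \<or> z = 4" by fastforce
  then show ?case by auto
qed

lemma vector_5_eqI:
  fixes v w :: "'a ^ 5"
  assumes "v $ 1 = w $ 1" "v $ 2 = w $ 2" "v $ 3 = w $ 3" "v $ 4 = w $ 4" "v $ 5 = w $ 5"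
  shows "v = w"
  unfolding vec_eq_iff
proof
  show "v $ i = w $ i" for i
    using exhaust_5[of i] assms by (elim disjE) simp_all
qed

lemma vector_5_eq_iff [simp]:
  fixes a b c d e :: "'a::zero"
  shows "(vector [a, b, c, d, e] :: 'a ^ 5) = vector [a', b', c', d', e'] \<longleftrightarrow>
     a = a' \<and> b = b' \<and> c = c' \<and> d = d' \<and> e = e'"
  by (metis vector_5)

lemma vector_5_simps [simp]:
  fixes a b c d e :: "'a::comm_ring_1"
  shows "(vector [a, b, c, d, e] :: 'a ^ 5) + vector [a', b', c', d', e'] =
      vector [a + a', b + b', c + c', d + d', e + e']"
    and "(vector [a, b, c, d, e] :: 'a ^ 5) - vector [a', b', c', d', e'] =
      vector [a - a', b - b', c - c', d - d', e - e']"
    and "- (vector [a, b, c, d, e] :: 'a ^ 5) = vector [- a, - b, - c, - d, - e]"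
    and "k *s (vector [a, b, c, d, e] :: 'a ^ 5) = vector [k * a, k * b, k * c, k * d, k * e]"
  by (rule vector_5_eqI; simp add: vector_5)+

lemma vector_5_cases:
  fixes v :: "'a::zero ^ 5"
  obtains a b c d e where "v = vector [a, b, c, d, e]"
proof
  show "v = vector [v $ 1, v $ 2, v $ 3, v $ 4, v $ 5]"
    by (rule vector_5_eqI) (simp_all add: vector_5)
qed

abbreviation S :: "(3 ^ 5) set" where "S \<equiv> BLS_connection_set"

abbreviation e1 :: "3 ^ 5" where "e1 \<equiv> vector [1, 0, 0, 0, 0]"
abbreviation e2 :: "3 ^ 5" where "e2 \<equiv> vector [0, 1, 0, 0, 0]"
abbreviation e3 :: "3 ^ 5" where "e3 \<equiv> vector [0, 0, 1, 0, 0]"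
abbreviation e4 :: "3 ^ 5" where "e4 \<equiv> vector [0, 0, 0, 1, 0]"
abbreviation e5 :: "3 ^ 5" where "e5 \<equiv> vector [0, 0, 0, 0, 1]"
abbreviation x1 :: "3 ^ 5" where "x1 \<equiv> vector [1, 1, 1, 1, 1]"

lemma S_eq: "S = {x1, vector [1, 1, 2, 2, 0], vector [1, 2, 1, 0, 2], vector [2, 1, 0, 1, 2],
    vector [2, 0, 1, 2, 1], vector [0, 2, 2, 1, 1], e1, e2, e3, e4, e5,
    vector [2, 2, 2, 2, 2], vector [2, 2, 1, 1, 0], vector [2, 1, 2, 0, 1], vector [1, 2, 0, 2, 1],
    vector [1, 0, 2, 1, 2], vector [0, 1, 1, 2, 2], vector [2, 0, 0, 0, 0], vector [0, 2, 0, 0, 0],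
    vector [0, 0, 2, 0, 0], vector [0, 0, 0, 2, 0], vector [0, 0, 0, 0, 2]}"
  unfolding BLS_connection_set_def BLS_vectors_def image_insert image_empty
    vector_5_simps F3_simps minus_zero
  by (simp only: Un_insert_left Un_empty_left)

lemma S_uminus_iff [simp]: "- v \<in> S \<longleftrightarrow> v \<in> S"
  using uminus_BLS_connection_set by (metis image_eqI minus_minus)

text \<open>The matrix with columns \<open>a\<close>, ..., \<open>e\<close>: the linear map sending
  the standard basis to these vectors in order.\<close>

definition linear_5 :: "3 ^ 5 \<Rightarrow> 3 ^ 5 \<Rightarrow> 3 ^ 5 \<Rightarrow> 3 ^ 5 \<Rightarrow> 3 ^ 5 \<Rightarrow> 3 ^ 5 \<Rightarrow> 3 ^ 5" where
  "linear_5 a b c d e v = v $ 1 *s a + v $ 2 *s b + v $ 3 *s c + v $ 4 *s d + v $ 5 *s e"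

lemma additive_linear_5: "additive (linear_5 a b c d e)"
  by unfold_locales (simp add: linear_5_def vector_sadd_rdistrib)

text \<open>Every scalar of a prime field is a sum of ones; hence \<open>additive\<close> can stand
  for linear throughout.\<close>

lemma additive_scale_F3:
  fixes f :: "3 ^ 'n \<Rightarrow> 3 ^ 'm"
  assumes "additive f"
  shows "f (k *s v) = k *s f v"
proof -
  interpret additive f by fact
  have two: "2 *s w = w + w" for w :: "3 ^ 'k::finite"
    by (simp add: vec_eq_iff)
  have "f (2 *s v) = 2 *s f v"
    unfolding two add ..
  then show ?thesis
    using exhaust_3[of k] by (auto simp: zero)
qed

lemma additive_eq_linear_5:
  assumes "additive f"
  shows "f = linear_5 (f e1) (f e2) (f e3) (f e4) (f e5)"
proof
  fix v :: "3 ^ 5"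
  obtain a b c d e where v: "v = vector [a, b, c, d, e]" by (rule vector_5_cases)
  then have "v = a *s e1 + b *s e2 + c *s e3 + d *s e4 + e *s e5" by simp
  then show "f v = linear_5 (f e1) (f e2) (f e3) (f e4) (f e5) v"
    by (simp only: additive.add[OF assms] additive_scale_F3[OF assms] linear_5_def)
       (simp add: vector_5)
qed

lemma additive_eqI:
  fixes f g :: "3 ^ 5 \<Rightarrow> 3 ^ 5"
  assumes "additive f" "additive g" "f e1 = g e1" "f e2 = g e2" "f e3 = g e3" "f e4 = g e4" "f e5 = g e5"
  shows "f = g"
  using additive_eq_linear_5[OF assms(1)] additive_eq_linear_5[OF assms(2)] assms(3-7) by simp

lemma additive_id [simp]: "additive id"
  by unfold_locales simp

lemma additive_comp: "additive f \<Longrightarrow> additive g \<Longrightarrow> additive (f \<circ> g)"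
  by (simp add: additive_def)

lemma additive_funpow: "additive (f :: 'a::ab_group_add \<Rightarrow> 'a) \<Longrightarrow> additive (f ^^ n)"
  by (induction n) (simp_all add: additive_comp)

section \<open>Transitivity on the eleven lines\<close>

text \<open>By \<open>S_linear_Aut\<close> and \<open>Aut_zero_S_linear\<close>, these are exactly
  the automorphisms of the graph that fix 0.\<close>

definition S_linear :: "(3 ^ 5 \<Rightarrow> 3 ^ 5) \<Rightarrow> bool" where
  "S_linear T \<longleftrightarrow> additive T \<and> bij T \<and> (\<forall>v. T v \<in> S \<longleftrightarrow> v \<in> S)"

lemma S_linear_comp: "S_linear T \<Longrightarrow> S_linear U \<Longrightarrow> S_linear (T \<circ> U)"
  by (simp add: S_linear_def additive_comp bij_comp)

lemma S_linear_id [simp]: "S_linear id"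
  by (simp add: S_linear_def)

lemma S_linear_funpow: "S_linear T \<Longrightarrow> S_linear (T ^^ n)"
  by (induction n) (simp_all add: S_linear_comp)

text \<open>Finite order makes the inverse a power of \<open>T\<close>, and powers of
  \<open>T\<close> map the connection set into itself. Eleven vectors suffice because
  \<open>T\<close> commutes with negation.\<close>

lemma S_linearI:
  assumes T: "additive T" and S: "\<forall>v\<in>BLS_vectors. T v \<in> S"
    and n: "T ^^ Suc n = id"
  shows "S_linear T"
proof -
  have sub: "T v \<in> S" if "v \<in> S" for v
  proof -
    from that consider "v \<in> BLS_vectors" | w where "v = - w" "w \<in> BLS_vectors"
      by (auto simp: BLS_connection_set_def)
    then show ?thesis using S by cases (auto simp: additive.minus[OF T])
  qed
  then have "(T ^^ k) v \<in> S" if "v \<in> S" for k v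
    using that by (induction k) auto
  moreover have inv: "(T ^^ n) (T v) = v" "T ((T ^^ n) v) = v" for v
    using n by (metis comp_apply funpow_Suc_right id_apply, metis comp_apply funpow.simps(2) id_apply)
  ultimately have "T v \<in> S \<longleftrightarrow> v \<in> S" for v using sub by metis
  moreover have "bij T" using inv by (metis bijI')
  ultimately show ?thesis using T by (simp add: S_linear_def)
qed

text \<open>
  Transitive extension: \<open>quat_i\<close> and \<open>quat_j\<close> preserve the lines of $x_1, e_1, e_2$ and generate,
  up to sign, a quaternion group that is regular on the other eight lines; each of the maps
  \<open>swap_e2_e3\<close>, \<open>swap_e1_e2\<close>, \<open>swap_x1_e1\<close> then makes one more line movable.
\<close>

definition "swap_x1_e1 = linear_5 (- x1) e3 e2 e4 e5"
definition "swap_e1_e2 = linear_5 e2 e1 e4 e3 e5"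
definition "swap_e2_e3 = linear_5 e1 e3 e2 e5 e4"
definition "quat_i = linear_5 e1 e2 (vector [2, 0, 1, 2, 1]) (- e3) (vector [2, 1, 2, 0, 1])"
definition "quat_j = linear_5 e1 (- e2) e5 (vector [1, 2, 1, 0, 2]) (vector [0, 1, 1, 2, 2])"
lemmas gen_defs = swap_x1_e1_def swap_e1_e2_def swap_e2_e3_def quat_i_def quat_j_def

lemma linear_5_vector:
  "linear_5 A B C D E (vector [a, b, c, d, e]) = a *s A + b *s B + c *s C + d *s D + e *s E"
  by (simp add: linear_5_def vector_5)

lemma S_linear_generators:
  "S_linear swap_x1_e1" "S_linear swap_e1_e2" "S_linear swap_e2_e3"
  "S_linear quat_i" "S_linear quat_j"
proof -
  have a: "additive swap_x1_e1" "additive swap_e1_e2" "additive swap_e2_e3"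
      "additive quat_i" "additive quat_j"
    by (simp_all add: gen_defs additive_linear_5)
  have "swap_x1_e1 ^^ Suc 1 = id" "swap_e1_e2 ^^ Suc 1 = id" "swap_e2_e3 ^^ Suc 1 = id"
      "quat_i ^^ Suc 3 = id" "quat_j ^^ Suc 3 = id"
    by (rule additive_eqI; simp add: a additive_funpow del: funpow.simps;
        simp add: gen_defs linear_5_vector eval_nat_numeral)+
  moreover have "\<forall>v\<in>BLS_vectors. swap_x1_e1 v \<in> S" "\<forall>v\<in>BLS_vectors. swap_e1_e2 v \<in> S"
      "\<forall>v\<in>BLS_vectors. swap_e2_e3 v \<in> S" "\<forall>v\<in>BLS_vectors. quat_i v \<in> S" "\<forall>v\<in>BLS_vectors. quat_j v \<in> S"
    by (simp_all add: BLS_vectors_def gen_defs linear_5_vector, simp_all add: S_eq)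
  ultimately show "S_linear swap_x1_e1" "S_linear swap_e1_e2" "S_linear swap_e2_e3"
      "S_linear quat_i" "S_linear quat_j"
    using a by (blast intro: S_linearI)+
qed

section \<open>The induced action on lines, with signs left open\<close>

abbreviation pm :: "'a::uminus \<Rightarrow> 'a set" where "pm v \<equiv> {v, - v}"

lemma pm_comp:
  assumes "additive U" "T a \<in> pm b" "U b \<in> pm c"
  shows "(U \<circ> T) a \<in> pm c"
  using assms by (auto simp: additive.minus)

lemma pm_funpow:
  assumes "additive (T :: 'a::ab_group_add \<Rightarrow> 'a)" "T a \<in> pm a"
  shows "(T ^^ n) a \<in> pm a"
  by (induction n) (use assms in \<open>auto simp: additive.minus\<close>)

lemma S_linearD:
  assumes "S_linear T"
  shows "additive T" "bij T" "T v \<in> S \<longleftrightarrow> v \<in> S" "T (- v) = - T v" "T 0 = 0"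
    "T v \<in> pm (T w) \<longleftrightarrow> v \<in> pm w"
proof -
  show a: "additive T" "bij T" "T v \<in> S \<longleftrightarrow> v \<in> S" using assms by (simp_all add: S_linear_def)
  from a(1) show *: "T (- v) = - T v" "T 0 = 0" for v by (simp_all add: additive.minus additive.zero)
  show "T v \<in> pm (T w) \<longleftrightarrow> v \<in> pm w"
    using bij_is_inj[OF a(2)] *[symmetric] by (simp add: inj_eq)
qed

lemma S_linear_notin_pm:
  assumes T: "S_linear T" and "T a \<in> pm b" "c \<notin> pm a"
  shows "T c \<notin> pm b"
proof -
  have "pm b = pm (T a)"
    using assms(2) by auto
  then show ?thesis
    using S_linearD(6)[OF T, of c a] assms(3) by simp
qed

lemma stabilizer_x1_e1_e2_transitive:
  assumes y: "y \<in> S" "y \<notin> pm x1" "y \<notin> pm e1" "y \<notin> pm e2"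
  shows "\<exists>T. S_linear T \<and> T x1 \<in> pm x1 \<and> T e1 \<in> pm e1 \<and> T e2 \<in> pm e2 \<and> T y \<in> pm e3"
proof -
  \<comment> \<open>These eight products represent the quaternion group up to sign, so by regularity
    one of them takes the line of \<open>y\<close> to that of \<open>e3\<close>.\<close>
  have "\<exists>i\<in>{0,1,2,3}. \<exists>j\<in>{0,1}. (quat_j ^^ j) ((quat_i ^^ i) y) \<in> pm e3"
    using y unfolding S_eq
    by (elim insertE emptyE; simp; simp add: gen_defs linear_5_vector eval_nat_numeral)
  then obtain i j where ij: "(quat_j ^^ j) ((quat_i ^^ i) y) \<in> pm e3" by metis
  define T where "T = quat_j ^^ j \<circ> quat_i ^^ i"
  have T: "S_linear T"
    unfolding T_def by (intro S_linear_comp S_linear_funpow S_linear_generators)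
  have "T v \<in> pm v" if "v \<in> {x1, e1, e2}" for v
    unfolding T_def using that
    by (intro pm_comp[where b = v] pm_funpow additive_funpow S_linearD(1)[OF S_linear_generators(4)]
        S_linearD(1)[OF S_linear_generators(5)]) (auto simp: gen_defs linear_5_vector)
  from this[of x1] this[of e1] this[of e2] have "T x1 \<in> pm x1" "T e1 \<in> pm e1" "T e2 \<in> pm e2"
    by (simp_all only: insertI1 insertI2)
  moreover have "T y \<in> pm e3"
    unfolding T_def comp_apply by (fact ij)
  ultimately show ?thesis
    using T by metis
qed

text \<open>A line other than that of \<open>e2\<close> is first moved to \<open>e3\<close>;
  \<open>swap_e2_e3\<close> then takes \<open>e3\<close> to \<open>e2\<close> and respects the lines
  of \<open>x1\<close> and \<open>e1\<close>. The next two lemmas repeat this with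
  \<open>swap_e1_e2\<close> and \<open>swap_x1_e1\<close>.\<close>

lemma stabilizer_x1_e1_transitive:
  assumes y: "y \<in> S" "y \<notin> pm x1" "y \<notin> pm e1"
  shows "\<exists>T. S_linear T \<and> T x1 \<in> pm x1 \<and> T e1 \<in> pm e1 \<and> T y \<in> pm e2"
proof (cases "y \<in> pm e2")
  case True
  then show ?thesis by (intro exI[of _ id]) auto
next
  case False
  obtain T where T: "S_linear T" "T x1 \<in> pm x1" "T e1 \<in> pm e1" "T y \<in> pm e3"
    using stabilizer_x1_e1_e2_transitive[OF y False] by metis
  note U = S_linear_generators(3)
  show ?thesis
    by (intro exI[of _ "swap_e2_e3 \<circ> T"] conjI S_linear_comp U T(1))
      (rule pm_comp[OF S_linearD(1)[OF U]], rule T, simp add: gen_defs linear_5_vector)+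
qed

lemma stabilizer_x1_transitive:
  assumes y: "y \<in> S" "y \<notin> pm x1"
  shows "\<exists>T. S_linear T \<and> T x1 \<in> pm x1 \<and> T y \<in> pm e1"
proof (cases "y \<in> pm e1")
  case True
  then show ?thesis by (intro exI[of _ id]) auto
next
  case False
  obtain T where T: "S_linear T" "T x1 \<in> pm x1" "T y \<in> pm e2"
    using stabilizer_x1_e1_transitive[OF y False] by metis
  note U = S_linear_generators(2)
  show ?thesis
    by (intro exI[of _ "swap_e1_e2 \<circ> T"] conjI S_linear_comp U T(1))
      (rule pm_comp[OF S_linearD(1)[OF U]], rule T, simp add: gen_defs linear_5_vector)+
qed

lemma transitive_lines:
  assumes y: "y \<in> S"
  shows "\<exists>T. S_linear T \<and> T y \<in> pm x1"
proof (cases "y \<in> pm x1")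
  case True
  then show ?thesis by (intro exI[of _ id]) auto
next
  case False
  obtain T where T: "S_linear T" "T y \<in> pm e1"
    using stabilizer_x1_transitive[OF y False] by metis
  note U = S_linear_generators(1)
  show ?thesis
    by (intro exI[of _ "swap_x1_e1 \<circ> T"] conjI S_linear_comp U T(1))
      (rule pm_comp[OF S_linearD(1)[OF U]], rule T, simp add: gen_defs linear_5_vector)+
qed

text \<open>The first line goes to \<open>x1\<close>; its stabilizer then moves the image of the
  second, still a different line by injectivity. The versions for three and four lines add one line
  at a time.\<close>

lemma two_transitive_lines:
  assumes "a \<in> S" "b \<in> S" "b \<notin> pm a"
  shows "\<exists>T. S_linear T \<and> T a \<in> pm x1 \<and> T b \<in> pm e1"
proof -
  obtain T where T: "S_linear T" "T a \<in> pm x1" using transitive_lines[OF assms(1)] by metis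
  have "T b \<notin> pm x1"
    by (rule S_linear_notin_pm[OF T assms(3)])
  then obtain U where U: "S_linear U" "U x1 \<in> pm x1" "U (T b) \<in> pm e1"
    using stabilizer_x1_transitive[of "T b"] S_linearD(3)[OF T(1)] assms(2) by metis
  show ?thesis
    by (intro exI[of _ "U \<circ> T"] conjI S_linear_comp U(1) T(1))
      (simp_all only: comp_apply U(3),
        (rule pm_comp[OF S_linearD(1)[OF U(1)], unfolded comp_apply], rule T, rule U)+)
qed

lemma three_transitive_lines:
  assumes "a \<in> S" "b \<in> S" "c \<in> S" "b \<notin> pm a" "c \<notin> pm a" "c \<notin> pm b"
  shows "\<exists>T. S_linear T \<and> T a \<in> pm x1 \<and> T b \<in> pm e1 \<and> T c \<in> pm e2"
proof -
  obtain T where T: "S_linear T" "T a \<in> pm x1" "T b \<in> pm e1"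
    using two_transitive_lines[OF assms(1,2,4)] by metis
  have "T c \<notin> pm x1" "T c \<notin> pm e1"
    by (rule S_linear_notin_pm[OF T(1)], rule T assms, rule assms)+
  then obtain U where U: "S_linear U" "U x1 \<in> pm x1" "U e1 \<in> pm e1" "U (T c) \<in> pm e2"
    using stabilizer_x1_e1_transitive[of "T c"] S_linearD(3)[OF T(1)] assms(3) by metis
  show ?thesis
    by (intro exI[of _ "U \<circ> T"] conjI S_linear_comp U(1) T(1))
      (simp_all only: comp_apply U(4),
        (rule pm_comp[OF S_linearD(1)[OF U(1)], unfolded comp_apply], rule T, rule U)+)
qed

lemma four_transitive_lines:
  assumes "a \<in> S" "b \<in> S" "c \<in> S" "d \<in> S" "b \<notin> pm a" "c \<notin> pm a" "d \<notin> pm a" "c \<notin> pm b"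
    "d \<notin> pm b" "d \<notin> pm c"
  shows "\<exists>T. S_linear T \<and> T a \<in> pm x1 \<and> T b \<in> pm e1 \<and> T c \<in> pm e2 \<and> T d \<in> pm e3"
proof -
  obtain T where T: "S_linear T" "T a \<in> pm x1" "T b \<in> pm e1" "T c \<in> pm e2"
    using three_transitive_lines[OF assms(1,2,3,5,6,8)] by metis
  have "T d \<notin> pm x1" "T d \<notin> pm e1" "T d \<notin> pm e2"
    by (rule S_linear_notin_pm[OF T(1)], rule T assms, rule assms)+
  then obtain U where U: "S_linear U" "U x1 \<in> pm x1" "U e1 \<in> pm e1" "U e2 \<in> pm e2" "U (T d) \<in> pm e3"
    using stabilizer_x1_e1_e2_transitive[of "T d"] S_linearD(3)[OF T(1)] assms(4) by metis
  show ?thesis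
    by (intro exI[of _ "U \<circ> T"] conjI S_linear_comp U(1) T(1))
      (simp_all only: comp_apply U(5),
        (rule pm_comp[OF S_linearD(1)[OF U(1)], unfolded comp_apply], rule T, rule U)+)
qed

text \<open>
  $\lambda = 1$: the only common neighbour of $0$ and $-x$ is $x$. The lemma after that is $\mu = 2$.
\<close>

lemma S_add_S:
  assumes "x \<in> S" "y \<in> S" "x + y \<in> S"
  shows "y = x"
proof (rule ccontr)
  assume "y \<noteq> x"
  have nz: "x \<noteq> 0" "y \<noteq> 0" "x + y \<noteq> 0"
    using assms zero_notin_BLS_connection_set by metis+
  then have "y \<noteq> - x" "x + y \<noteq> x" "x + y \<noteq> y"
    by auto
  moreover have "x + y \<noteq> - x" "x + y \<noteq> - y"
    using \<open>y \<noteq> x\<close> double_F3_vec(1)[of x] double_F3_vec(1)[of y]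
    by (metis add_diff_cancel_left', metis add_diff_cancel_right')
  ultimately obtain T where T: "S_linear T" "T x \<in> pm x1" "T y \<in> pm e1" "T (x + y) \<in> pm e2"
    using three_transitive_lines[of x y "x + y"] assms \<open>y \<noteq> x\<close> by auto
  \<comment> \<open>Up to sign, \<open>e2\<close> would be a signed sum of \<open>x1\<close> and
    \<open>e1\<close>, contrary to linear independence.\<close>
  then show False by (auto simp: additive.add[OF S_linearD(1)])
qed

lemma S_add_eq_S_add:
  assumes S: "p \<in> S" "q \<in> S" "z \<in> S" "w \<in> S" and "q \<notin> pm p" and eq: "p + z = q + w"
  shows "z = q \<or> z = - p"
proof (rule ccontr)
  assume neg: "\<not> (z = q \<or> z = - p)"
  \<comment> \<open>This is lambda = 1. Any coincidence among the lines of \<open>p\<close>,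
    \<open>q\<close>, \<open>z\<close>, \<open>w\<close> is refuted below by one of these two facts,
    by the excluded values of \<open>z\<close>, or by \<open>p\<close> and \<open>q\<close> being on
    different lines.\<close>
  have no: "p + q \<notin> S" "p - q \<notin> S"
    using S_add_S[of p q] S_add_S[of p "- q"] S assms(5) by auto
  have sum_0: "- w' = u + v" if "u + u = v + w'" for u v w' :: "3 ^ 5"
  proof (rule minus_unique)
    have "w' + (u + v) = u + (v + w')" by (simp add: add_ac)
    also have "\<dots> = u + - u" by (simp only: that[symmetric] double_F3_vec)
    finally show "w' + (u + v) = 0" by simp
  qed
  have "z \<notin> pm p"
  proof
    assume "z \<in> pm p"
    then have "z = p" using neg by auto
    then have "- w = p + q" using sum_0[of p q w] eq by metis
    then show False using no S S_uminus_iff by metis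
  qed
  moreover have "z \<notin> pm q"
  proof
    assume "z \<in> pm q"
    then have "z = - q" using neg by auto
    then have "w = p + (- q - q)" using eq by (simp add: algebra_simps)
    then have "w = p + q" unfolding double_F3_vec by (simp add: add.commute)
    then show False using no S S_uminus_iff by metis
  qed
  moreover have "w \<notin> pm p"
  proof
    assume "w \<in> pm p"
    then have "w = - p" using neg eq by auto
    then have "z = q + (- p - p)" using eq by (simp add: algebra_simps)
    then have "z = p + q" unfolding double_F3_vec by (simp add: add.commute)
    then show False using no S S_uminus_iff by metis
  qed
  moreover have "w \<notin> pm q"
  proof
    assume "w \<in> pm q"
    then consider "w = q" | "w = - q" by auto
    then show False
    proof cases
      case 1
      then have "- z = p + q" using sum_0[of q p z] eq by (metis add.commute)
      then show False using no S S_uminus_iff by metis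
    next
      case 2 then show False using eq neg by (simp add: eq_neg_iff_add_eq_0 add.commute)
    qed
  qed
  moreover have "w \<notin> pm z"
  proof
    assume "w \<in> pm z"
    then have "w = - z" using eq assms(5) by auto
    then have "p - q = - z - z" using eq by (simp add: algebra_simps)
    then have "p - q = z" unfolding double_F3_vec .
    then show False using no S by metis
  qed
  ultimately obtain T where "S_linear T" "T p \<in> pm x1" "T q \<in> pm e1" "T z \<in> pm e2" "T w \<in> pm e3"
    using four_transitive_lines[of p q z w] assms by metis
  \<comment> \<open>A relation between \<open>x1\<close>, \<open>e1\<close>, \<open>e2\<close>,
    \<open>e3\<close> with all coefficients nonzero, although they are independent.\<close>
  moreover have "T p + T z = T q + T w"
    using eq additive.add[OF S_linearD(1)[OF \<open>S_linear T\<close>]] by metis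
  ultimately show False by auto
qed

section \<open>Automorphisms fixing a vertex are linear\<close>

text \<open>Connectedness of the graph: the connection set contains the standard basis, and adding
  \<open>2 *s x\<close> amounts to two steps by \<open>x\<close>.\<close>

lemma S_induct [case_names zero add]:
  assumes "P 0" and add: "\<And>u x. P u \<Longrightarrow> x \<in> S \<Longrightarrow> P (u + x)"
  shows "P v"
proof -
  have step: "P (u + k *s x)" if "P u" "x \<in> S" for u x and k :: 3
  proof -
    have "u + 2 *s x = u + x + x" by (simp add: vec_eq_iff)
    then have "P (u + 2 *s x)" using add[OF add[OF that] that(2)] by metis
    then show ?thesis using exhaust_3[of k] that add by auto
  qed
  obtain a b c d e where "v = vector [a, b, c, d, e]" by (rule vector_5_cases)
  then have "v = 0 + a *s e1 + b *s e2 + c *s e3 + d *s e4 + e *s e5" by simp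
  moreover have "P (0 + a *s e1 + b *s e2 + c *s e3 + d *s e4 + e *s e5)"
    by (intro step assms(1)) (simp_all add: S_eq)
  ultimately show ?thesis by simp
qed

abbreviation "Aut \<equiv> carrier (aut_group BLS_adj)"

lemma BLS_adj_iff: "BLS_adj u v \<longleftrightarrow> u - v \<in> S"
  by (simp add: BLS_adj_def cayley_adj_def)

lemma mem_Aut: "f \<in> Aut \<longleftrightarrow> bij f \<and> (\<forall>u v. f u - f v \<in> S \<longleftrightarrow> u - v \<in> S)"
  by (simp add: mem_aut_group_iff BLS_adj_iff)

lemma S_linear_Aut: "S_linear T \<Longrightarrow> T \<in> Aut"
  by (simp add: mem_Aut S_linear_def flip: additive.diff)

lemma translation_Aut: "(\<lambda>v. v + w) \<in> Aut"
proof -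
  have "bij (\<lambda>v. v + w)" by (rule bijI'[where f = "\<lambda>v. v + w"]) (auto intro: exI[of _ "_ - w"])
  then show ?thesis by (simp add: mem_Aut)
qed

lemma comp_Aut: "f \<in> Aut \<Longrightarrow> g \<in> Aut \<Longrightarrow> f \<circ> g \<in> Aut"
  by (simp add: mem_Aut bij_comp)

text \<open>For distinct lines, \<open>f (x + y)\<close> is a common neighbour of \<open>f x\<close>
  and \<open>f y\<close>; by mu = 2 the only ones are 0 and \<open>f x + f y\<close>, and 0 is
  already the image of 0. Within one line, lambda = 1 determines the image of the triangle 0,
  \<open>v\<close>, \<open>- v\<close>.\<close>

lemma Aut_zero_add_S:
  assumes f: "f \<in> Aut" "f 0 = 0" and S: "x \<in> S" "y \<in> S"
  shows "f (x + y) = f x + f y"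
proof -
  have inj: "f u = f v \<longleftrightarrow> u = v" for u v
    using f(1) by (simp add: mem_Aut bij_def inj_eq)
  have adj: "f u - f v \<in> S \<longleftrightarrow> u - v \<in> S" for u v
    using f(1) by (simp add: mem_Aut)
  have fS: "f v \<in> S \<longleftrightarrow> v \<in> S" for v
    using adj[of v 0] f(2) by simp
  have neg: "f (- v) = - f v" if "v \<in> S" for v
  proof -
    have "f v - f (- v) \<in> S"
      using that by (simp only: adj diff_minus_eq_add double_F3_vec S_uminus_iff)
    then have "- f (- v) = f v"
      using S_add_S[of "f v" "- f (- v)"] fS that by simp
    then show ?thesis by (metis minus_minus)
  qed
  consider "y = x" | "y = - x" | "y \<notin> pm x" by blast
  then show ?thesis
  proof cases
    case 1 then show ?thesis using double_F3_vec(2) neg[OF S(1)] by metis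
  next
    case 2 then show ?thesis using f(2) neg[OF S(1)] by simp
  next
    case 3
    define z where "z = f (x + y) - f x"
    define w where "w = f (x + y) - f y"
    have "z \<in> S" "w \<in> S" using S by (simp_all add: z_def w_def adj)
    moreover have "f y \<notin> pm (f x)" using 3 inj neg S by (metis insert_iff empty_iff)
    moreover have "f x + z = f y + w" by (simp add: z_def w_def)
    ultimately consider "z = f y" | "z = - f x"
      using S_add_eq_S_add[of "f x" "f y" z w] S fS by blast
    then show ?thesis
    proof cases
      case 1 then show ?thesis by (simp add: z_def algebra_simps)
    next
      case 2
      then have "f (x + y) = f 0" using f(2) by (simp add: z_def)
      then have "y = - x" unfolding inj by (simp add: add_eq_0_iff)
      with 3 show ?thesis by simp
    qed
  qed
qed

lemma Aut_zero_S_linear: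
  assumes f: "f \<in> Aut" "f 0 = 0"
  shows "S_linear f"
proof -
  \<comment> \<open>Translations turn \<open>f\<close> into the automorphism sending
    \<open>x\<close> to \<open>f (u + x) - f u\<close>, which fixes 0.\<close>
  have loc: "f (u + x + y) - f u = (f (u + x) - f u) + (f (u + y) - f u)"
    if "x \<in> S" "y \<in> S" for u x y
  proof -
    have "(\<lambda>v. v + - f u) \<circ> f \<circ> (\<lambda>v. v + u) \<in> Aut"
      by (intro comp_Aut translation_Aut f(1))
    from Aut_zero_add_S[OF this _ that] show ?thesis by (simp add: add_ac)
  qed
  \<comment> \<open>By \<open>loc\<close>, the difference \<open>f (u + x) - f u\<close> does not
    change when \<open>u\<close> moves along an edge, so it equals its value \<open>f x\<close> at
    \<open>u = 0\<close>.\<close>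
  have step: "f (u + x) = f u + f x" if "x \<in> S" for u x
    using that
  proof (induction u arbitrary: x rule: S_induct)
    case zero
    then show ?case using f(2) by simp
  next
    case (add u y)
    have "f (u + y + x) = f (u + y) + (f (u + x) - f u)"
      using loc[of y x u] add(2,3) by (simp add: algebra_simps)
    then show ?case using add.IH[OF add(3)] by simp
  qed
  have "f (u + v) = f u + f v" for u v
  proof (induction v rule: S_induct)
    case zero
    then show ?case using f(2) by simp
  next
    case (add v x)
    then show ?case using step[of x v] step[of x "u + v"] by (simp add: add.assoc)
  qed
  then have "additive f" by unfold_locales
  moreover have "f v \<in> S \<longleftrightarrow> v \<in> S" for v
    using f by (simp add: mem_Aut) (metis diff_zero)
  ultimately show ?thesis using f(1) by (simp add: S_linear_def mem_Aut)
qed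

lemma Aut_fixpoint_affine:
  assumes f: "f \<in> Aut" "f w = w"
  obtains g where "S_linear g" "\<And>v. f (v + w) = g v + w"
proof
  let ?g = "(\<lambda>v. v + - w) \<circ> f \<circ> (\<lambda>v. v + w)"
  show "S_linear ?g"
    by (intro Aut_zero_S_linear comp_Aut translation_Aut f(1)) (simp add: f(2))
  show "f (v + w) = ?g v + w" for v by simp
qed

section \<open>Involutions\<close>

lemma ord_2_iff:
  assumes "f \<in> Aut"
  shows "group.ord (aut_group BLS_adj) f = 2 \<longleftrightarrow> f \<noteq> id \<and> f \<circ> f = id"
proof -
  interpret group "aut_group BLS_adj" by (rule group_aut_group)
  have sq: "f [^]\<^bsub>aut_group BLS_adj\<^esub> (2::nat) = f \<circ> f"
    using assms by (simp add: numeral_2_eq_2 mult_aut_group)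
  have one: "f [^]\<^bsub>aut_group BLS_adj\<^esub> (1::nat) = f" using assms by simp
  show ?thesis
  proof
    assume "ord f = 2"
    then show "f \<noteq> id \<and> f \<circ> f = id"
      using pow_ord_eq_1[OF assms] sq ord_eq_1[OF assms] by (auto simp: one_aut_group)
  next
    assume *: "f \<noteq> id \<and> f \<circ> f = id"
    then have "ord f dvd 2" using pow_eq_id[OF assms, of 2] sq by (simp add: one_aut_group)
    moreover have "ord f \<noteq> 1" using ord_eq_1[OF assms] * by (simp add: one_aut_group)
    ultimately show "ord f = 2" using dvd_imp_le[of "ord f" 2] by (cases "ord f = 0") auto
  qed
qed

lemma conjugateI:
  assumes "f \<in> Aut" "g \<in> Aut" "h \<in> Aut" "h \<circ> f = g \<circ> h"
  shows "conjugate_in (aut_group BLS_adj) f g"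
proof -
  interpret group "aut_group BLS_adj" by (rule group_aut_group)
  have "h \<otimes>\<^bsub>aut_group BLS_adj\<^esub> f = g \<otimes>\<^bsub>aut_group BLS_adj\<^esub> h"
    using assms by (simp add: mult_aut_group)
  then have "g = h \<otimes>\<^bsub>aut_group BLS_adj\<^esub> f \<otimes>\<^bsub>aut_group BLS_adj\<^esub> inv\<^bsub>aut_group BLS_adj\<^esub> h"
    using assms by (simp add: m_assoc)
  then show ?thesis using assms(3) unfolding conjugate_in_def by blast
qed

text \<open>Removing one orbit, a pair, leaves a smaller set with a fixed-point-free
  involution.\<close>

lemma even_card_involution:
  assumes "finite A" "\<And>a. a \<in> A \<Longrightarrow> f a \<in> A"
    "\<And>a. a \<in> A \<Longrightarrow> f (f a) = a" "\<And>a. a \<in> A \<Longrightarrow> f a \<noteq> a"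
  shows "even (card A)"
  using assms
proof (induction A rule: finite_psubset_induct)
  case (psubset A)
  show ?case
  proof (cases "A = {}")
    case False
    then obtain a where a: "a \<in> A" by blast
    let ?B = "A - {a, f a}"
    have "even (card ?B)"
    proof (rule psubset.IH)
      show "?B \<subset> A" using a by blast
      fix b assume b: "b \<in> ?B"
      then show "f b \<in> ?B" using psubset.prems(1,2)[of b] psubset.prems(2)[OF a] by auto
    qed (use psubset.prems in auto)
    moreover have "card A = card ?B + 2"
      using psubset.prems(1,3)[OF a] a psubset.hyps(1) card_Diff_subset[of "{a, f a}" A]
        card_mono[of A "{a, f a}"] by auto
    ultimately show ?thesis by simp
  qed simp
qed

lemma involution_fixpoint:
  fixes f :: "3 ^ 5 \<Rightarrow> 3 ^ 5"
  assumes "f \<circ> f = id"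
  shows "\<exists>v. f v = v"
proof (rule ccontr)
  assume "\<nexists>v. f v = v"
  then have "even (card (UNIV :: (3 ^ 5) set))"
    using assms by (intro even_card_involution[where f = f]) (auto simp: fun_eq_iff)
  then show False by simp
qed

lemma S_linear_inverse:
  assumes "S_linear T"
  obtains R where "S_linear R" "\<And>v. R (T v) = v" "\<And>v. T (R v) = v"
proof
  let ?R = "inv_into UNIV T"
  show RT: "?R (T v) = v" and TR: "T (?R v) = v" for v
    using S_linearD(2)[OF assms] by (simp_all add: bij_is_inj bij_is_surj surj_f_inv_f)
  have "?R (u + v) = ?R u + ?R v" for u v
    using additive.add[OF S_linearD(1)[OF assms], of "?R u" "?R v"] RT TR by metis
  then have "additive ?R" by unfold_locales
  moreover have "?R v \<in> S \<longleftrightarrow> v \<in> S" for v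
    using S_linearD(3)[OF assms, of "?R v"] TR by simp
  ultimately show "S_linear ?R"
    using bij_imp_bij_inv[OF S_linearD(2)[OF assms]] by (simp add: S_linear_def)
qed

section \<open>Involutions interchanging only adjacent vertices\<close>

lemma e_in_S: "e1 \<in> S" "e2 \<in> S" "e3 \<in> S" "e4 \<in> S" "e5 \<in> S" "x1 \<in> S"
  by (simp_all add: S_eq)

text \<open>This is lambda = 1 seen from 0: two adjacent neighbours of 0 complete the only triangle
  on the edge from 0 to \<open>x\<close>.\<close>

lemma S_diff_eq:
  fixes x :: "3 ^ 5"
  shows "x \<in> S \<Longrightarrow> y \<in> S \<Longrightarrow> x - y \<in> S \<Longrightarrow> y = - x"
  using S_add_S[of x "- y"] by (metis S_uminus_iff minus_equation_iff uminus_add_conv_diff add.commute)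

lemma not_interchanges_only_adjacent:
  assumes f: "f \<in> Aut" "f \<noteq> id" "f \<circ> f = id"
  shows "\<not> interchanges_only_adjacent BLS_adj f"
proof
  assume "interchanges_only_adjacent BLS_adj f"
  then have only: "u - f u \<in> S" if "f u \<noteq> u" for u
    using that by (simp add: interchanges_only_adjacent_def BLS_adj_iff)
  have ff: "f (f u) = u" for u using f(3) by (metis comp_apply id_apply)
  have adj: "f u - f v \<in> S \<longleftrightarrow> u - v \<in> S" for u v
    using f(1) by (simp add: mem_Aut)
  obtain u where u: "f u \<noteq> u" using f(2) by fastforce
  \<comment> \<open>The triangle on the swapped edge consists of \<open>u\<close>,
    \<open>f u = u - x\<close> and \<open>w = u + x\<close>.\<close>
  define x where "x = u - f u"
  have x: "x \<in> S" unfolding x_def by (rule only[OF u])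
  define w where "w = u + x"
  have w1: "w - u \<in> S" using x by (simp add: w_def)
  have "w - f u = x + x" by (simp add: w_def x_def)
  then have w2: "w - f u \<in> S" using x double_F3_vec(2)[of x] by (metis S_uminus_iff)
  \<comment> \<open>As \<open>f\<close> swaps \<open>u\<close> and \<open>f u\<close>, the vertex
    \<open>f w\<close> is adjacent to both; lambda = 1 leaves only \<open>w\<close>.\<close>
  have "f w - u \<in> S" using w2 adj[of w "f u"] ff by simp
  moreover have "x + (f w - u) \<in> S"
    using w1 adj[of w u] by (simp add: x_def)
  ultimately have "f w = w" using S_add_S[OF x] by (metis w_def add.commute diff_add_cancel)
  obtain g where g: "S_linear g" and g_eq: "\<And>v. f (v + w) = g v + w"
    using Aut_fixpoint_affine[OF f(1) \<open>f w = w\<close>] by metis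
  note add = additive.add[OF S_linearD(1)[OF g]]
  have neg: "g y = - y" if "y \<in> S" "g y \<noteq> y" for y
  proof -
    have "y - g y \<in> S" using only[of "y + w"] that(2) by (simp add: g_eq)
    then show ?thesis using S_diff_eq[OF that(1)] S_linearD(3)[OF g] that(1) by blast
  qed
  \<comment> \<open>If \<open>g\<close> negated a second line, it would negate \<open>x + y\<close>
    as well. The hypothesis on \<open>f\<close> would then put \<open>x + y\<close> into the
    connection set, contrary to lambda = 1.\<close>
  have fix_S: "g y = y" if "y \<in> S" "y \<notin> pm x" for y
  proof (rule ccontr)
    assume "g y \<noteq> y"
    then have y: "g y = - y" by (rule neg[OF that(1)])
    \<comment> \<open>Seen from \<open>w\<close>, the swapped vertices are \<open>w - x\<close> and
      \<open>w + x\<close>; hence \<open>g\<close> negates \<open>x\<close>.\<close>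
    have "f u = w - x - x" by (simp add: w_def x_def)
    also have "\<dots> = w + (- x - x)" by simp
    finally have "f u = x + w" unfolding double_F3_vec by (simp add: add.commute)
    then have "f (x + w) = u" using ff[of u] by simp
    then have "f (x + w) = w + - x" by (simp add: w_def)
    then have gx: "g x = - x" by (simp add: g_eq)
    have gxy: "g (x + y) = - (x + y)" unfolding add gx y by simp
    have "x + y \<noteq> 0" using that(2) by (auto simp: add_eq_0_iff)
    then have "g (x + y) \<noteq> x + y"
      using double_F3_vec(1)[of "x + y"] gxy by (metis cancel_comm_monoid_add_class.diff_cancel)
    then have "x + y - g (x + y) \<in> S"
      using only[of "x + y + w"] by (simp add: g_eq)
    then have "x + y \<in> S"
      unfolding gxy diff_minus_eq_add double_F3_vec S_uminus_iff .
    then show False using S_add_S[OF x that(1)] that(2) by simp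
  qed
  \<comment> \<open>With the line of \<open>x\<close> moved to \<open>x1\<close>, the five basis
    lines are among the others, so \<open>g\<close> fixes the pulled-back basis.\<close>
  obtain T where T: "S_linear T" "T x \<in> pm x1" using transitive_lines[OF x] by metis
  obtain R where R: "S_linear R" "\<And>v. R (T v) = v" "\<And>v. T (R v) = v"
    using S_linear_inverse[OF T(1)] by metis
  have "g (R e) = R e" if "e \<in> {e1, e2, e3, e4, e5}" for e
  proof (rule fix_S)
    show "R e \<in> S" using that S_linearD(3)[OF R(1)] e_in_S by auto
    have "e \<notin> pm x1" using that by auto
    then show "R e \<notin> pm x"
      using S_linearD(6)[OF T(1), of "R e" x] T(2) R(3) by auto
  qed
  then have "g \<circ> R = R"
    by (intro additive_eqI additive_comp S_linearD(1)[OF g] S_linearD(1)[OF R(1)]) simp_all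
  then have "g v = v" for v using R(2) by (metis comp_apply)
  then have "f u = u" using g_eq[of "u - w"] by simp
  then show False using u by simp
qed

section \<open>Involutions interchanging only non-adjacent vertices\<close>

text \<open>The linear part at a fixed point \<open>w\<close>: the neighbours \<open>w + x\<close>
  and \<open>w - x\<close> are adjacent to each other, so they must not be swapped.\<close>

definition S_involution :: "(3 ^ 5 \<Rightarrow> 3 ^ 5) \<Rightarrow> bool" where
  "S_involution f \<longleftrightarrow> S_linear f \<and> f \<circ> f = id \<and> f \<noteq> id \<and> (\<forall>x\<in>S. f x \<noteq> - x)"

lemma S_involution_conjugate:
  assumes f: "S_involution f" and T: "S_linear T" and R: "S_linear R"
    and inv: "\<And>v. R (T v) = v" "\<And>v. T (R v) = v"
  shows "S_involution (T \<circ> f \<circ> R)"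
proof -
  have ff: "f (f v) = v" for v using f unfolding S_involution_def by (metis comp_apply id_apply)
  have "T \<circ> f \<circ> R \<noteq> id"
  proof
    assume "T \<circ> f \<circ> R = id"
    then have "f v = v" for v using inv by (metis comp_apply id_apply)
    then show False using f by (auto simp: S_involution_def)
  qed
  moreover have "(T \<circ> f \<circ> R) x \<noteq> - x" if "x \<in> S" for x
  proof
    assume "(T \<circ> f \<circ> R) x = - x"
    then have "f (R x) = - R x" using inv S_linearD(4)[OF R] by (metis comp_apply)
    then show False using f that S_linearD(3)[OF R] by (auto simp: S_involution_def)
  qed
  ultimately show ?thesis
    using f T R by (auto simp: S_involution_def S_linear_comp fun_eq_iff inv ff)
qed

lemma conjugate_pm:
  assumes "S_linear f" "S_linear T" "S_linear R" "\<And>v. R (T v) = v"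
    and "f a \<in> pm b" "T a \<in> pm a'" "T b \<in> pm b'"
  shows "(T \<circ> f \<circ> R) a' \<in> pm b'"
proof -
  have "a' = T a \<or> a' = - T a" using assms(6) by auto
  then have "R a' = a \<or> R a' = - a"
    using assms(4) S_linearD(4)[OF assms(3)] by metis
  then have "f (R a') \<in> pm b"
    using assms(5) S_linearD(4)[OF assms(1)] by auto
  then show ?thesis
    using assms(7) S_linearD(4)[OF assms(2)] by auto
qed

text \<open>Being an involution leaves four choices of signs. As \<open>x1\<close> is the sum of the
  basis, \<open>f e4\<close> determines \<open>f e5\<close>; with the image of one more vector,
  membership in the connection set leaves only \<open>swap_x1_e1\<close> and its negative.\<close>

lemma S_involution_canonical:
  assumes f: "S_involution f" and 1: "f x1 \<in> pm e1" and 2: "f e2 \<in> pm e3"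
  shows "f = swap_x1_e1"
proof -
  have lin: "S_linear f" and ff: "f (f v) = v" and no: "x \<in> S \<Longrightarrow> f x \<noteq> - x" for v x
    using f unfolding S_involution_def by (auto simp: fun_eq_iff)
  note neg = S_linearD(4)[OF lin]
  have f4: "f e4 \<in> S" using S_linearD(3)[OF lin] e_in_S by blast
  have f5: "f e5 \<in> S" using S_linearD(3)[OF lin] e_in_S by blast
  have e1: "f e1 = x1 \<and> f x1 = e1 \<or> f e1 = - x1 \<and> f x1 = - e1"
    using 1 ff[of x1] neg[of e1] by (metis empty_iff insert_iff minus_minus)
  have e2: "f e2 = e3 \<and> f e3 = e2 \<or> f e2 = - e3 \<and> f e3 = - e2"
    using 2 ff[of e2] neg[of e3] by (metis empty_iff insert_iff minus_minus)
  have lin5: "f = linear_5 (f e1) (f e2) (f e3) (f e4) (f e5)"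
    by (rule additive_eq_linear_5) (rule S_linearD(1)[OF lin])
  have "f x1 = f e1 + f e2 + f e3 + f e4 + f e5"
    by (subst lin5) (simp add: linear_5_vector)
  then have f5_eq: "f e5 = f x1 - f e1 - f e2 - f e3 - f e4" by (simp add: algebra_simps)
  \<comment> \<open>The extra vector is (1,1,2,2,0), that is
    \<open>e1 + e2 - e3 - e4\<close>.\<close>
  have x2: "f e1 + f e2 - f e3 - f e4 \<in> S"
  proof -
    have "f e1 + f e2 - f e3 - f e4 = f (e1 + e2 - e3 - e4)"
      by (simp only: additive.add[OF S_linearD(1)[OF lin]] additive.diff[OF S_linearD(1)[OF lin]])
    also have "\<dots> \<in> S" unfolding S_linearD(3)[OF lin] by (simp add: S_eq)
    finally show ?thesis .
  qed
  have n4: "f e4 \<noteq> - e4" using no e_in_S by blast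
  consider "f e1 = x1" "f x1 = e1" "f e2 = e3" "f e3 = e2"
    | "f e1 = x1" "f x1 = e1" "f e2 = - e3" "f e3 = - e2"
    | "f e1 = - x1" "f x1 = - e1" "f e2 = e3" "f e3 = e2"
    | "f e1 = - x1" "f x1 = - e1" "f e2 = - e3" "f e3 = - e2"
    using e1 e2 by metis
  then have "f e1 = - x1 \<and> f e2 = e3 \<and> f e3 = e2 \<and> f e4 = e4 \<and> f e5 = e5"
  proof cases
    case 1
    note * = f5[unfolded f5_eq 1 vector_5_simps] x2[unfolded 1 vector_5_simps]
    show ?thesis
      using f4[unfolded S_eq] * by (elim insertE emptyE; simp; simp add: S_eq)
  next
    \<comment> \<open>The surviving candidate is the negative of \<open>swap_x1_e1\<close>; it
      negates \<open>e4\<close>, against \<open>n4\<close>.\<close>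
    case 2
    note * = f5[unfolded f5_eq 2 vector_5_simps] x2[unfolded 2 vector_5_simps]
    show ?thesis
      using f4[unfolded S_eq] * n4 by (elim insertE emptyE; simp; simp add: S_eq)
  next
    case 3
    note * = f5[unfolded f5_eq 3 vector_5_simps] x2[unfolded 3 vector_5_simps]
    show ?thesis unfolding f5_eq 3
      using f4[unfolded S_eq] * by (elim insertE emptyE; simp; simp add: S_eq)
  next
    case 4
    note * = f5[unfolded f5_eq 4 vector_5_simps] x2[unfolded 4 vector_5_simps]
    show ?thesis
      using f4[unfolded S_eq] * by (elim insertE emptyE; simp; simp add: S_eq)
  qed
  then show ?thesis
    using lin5 unfolding swap_x1_e1_def by metis
qed

lemma S_involution_swap_x1_e1: "S_involution swap_x1_e1"
proof -
  have "swap_x1_e1 \<circ> swap_x1_e1 = id"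
    by (rule additive_eqI; simp add: gen_defs linear_5_vector additive_comp additive_linear_5)
  moreover have "swap_x1_e1 e2 \<noteq> id e2" by (simp add: gen_defs linear_5_vector)
  then have "swap_x1_e1 \<noteq> id" by metis
  moreover have "swap_x1_e1 x \<noteq> - x" if "x \<in> S" for x
    using that unfolding S_eq by (elim insertE emptyE; simp add: gen_defs linear_5_vector)
  ultimately show ?thesis
    using S_linear_generators(1) by (simp add: S_involution_def)
qed

lemma S_involution_fixes:
  assumes "S_involution f" "x \<in> S" "f x \<in> pm x"
  shows "f x = x"
  using assms by (auto simp: S_involution_def)

lemma S_involution_conj_swap_x1_e1:
  assumes f: "S_involution f"
  obtains R where "S_linear R" "f \<circ> R = R \<circ> swap_x1_e1"
proof -
  have lin: "S_linear f" using f by (simp add: S_involution_def)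
  \<comment> \<open>If every line were preserved, each would be fixed pointwise, since none is
    negated, and \<open>f\<close> would be the identity.\<close>
  obtain a where a: "a \<in> S" "f a \<notin> pm a"
  proof (rule ccontr)
    assume "\<not> thesis"
    then have "f x = x" if "x \<in> S" for x
      using S_involution_fixes[OF f that] that \<open>\<And>a. a \<in> S \<Longrightarrow> f a \<notin> pm a \<Longrightarrow> thesis\<close> by metis
    then have "f = id"
      by (intro additive_eqI S_linearD(1)[OF lin] additive_id) (simp_all add: e_in_S)
    then show False using f by (simp add: S_involution_def)
  qed
  obtain T where T: "S_linear T" "T a \<in> pm x1" "T (f a) \<in> pm e1"
    using two_transitive_lines[OF a(1) _ a(2)] a(1) S_linearD(3)[OF lin, of a] by metis
  obtain R where R: "S_linear R" "\<And>v. R (T v) = v" "\<And>v. T (R v) = v"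
    using S_linear_inverse[OF T(1)] by metis
  define g where "g = T \<circ> f \<circ> R"
  have g: "S_involution g"
    unfolding g_def by (rule S_involution_conjugate[OF f T(1) R])
  then have g_lin: "S_linear g" and gg: "g (g v) = v" for v
    unfolding S_involution_def by (auto simp: fun_eq_iff)
  have g_x1: "g x1 \<in> pm e1"
    unfolding g_def by (rule conjugate_pm[OF lin T(1) R(1,2) _ T(2,3)]) simp
  have g_e1: "g e1 \<in> pm x1"
    using g_x1 gg[of x1] S_linearD(4)[OF g_lin, of e1] by (metis insert_iff empty_iff minus_minus)
  \<comment> \<open>A second swapped pair: were the other nine lines fixed, so would be
    \<open>e1\<close>, a combination of \<open>?x2\<close>, \<open>e2\<close>, \<open>e3\<close> and
    \<open>e4\<close>.\<close>
  obtain c where c: "c \<in> S" "c \<notin> pm x1" "c \<notin> pm e1" "g c \<notin> pm c"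
  proof (rule ccontr)
    assume "\<not> thesis"
    then have fixed: "g x = x" if "x \<in> S" "x \<notin> pm x1" "x \<notin> pm e1" for x
      using S_involution_fixes[OF g that(1)] that
        \<open>\<And>c. c \<in> S \<Longrightarrow> c \<notin> pm x1 \<Longrightarrow> c \<notin> pm e1 \<Longrightarrow> g c \<notin> pm c \<Longrightarrow> thesis\<close> by metis
    let ?x2 = "vector [1, 1, 2, 2, 0] :: 3 ^ 5"
    have "g e2 = e2" "g e3 = e3" "g e4 = e4" "g ?x2 = ?x2"
      by (intro fixed; simp add: S_eq)+
    moreover have "g (?x2 - e2 + e3 + e4) = g ?x2 - g e2 + g e3 + g e4"
      by (simp only: additive.add[OF S_linearD(1)[OF g_lin]] additive.diff[OF S_linearD(1)[OF g_lin]])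
    ultimately have "g e1 = e1" by simp
    then show False using g_e1 by simp
  qed
  have "g c \<notin> pm x1"
    using S_linear_notin_pm[OF g_lin g_e1 c(3)] .
  moreover have "g c \<notin> pm e1"
    using S_linear_notin_pm[OF g_lin g_x1 c(2)] .
  ultimately obtain U where U: "S_linear U" "U x1 \<in> pm x1" "U e1 \<in> pm e1" "U c \<in> pm e2" "U (g c) \<in> pm e3"
    using four_transitive_lines[of x1 e1 c "g c"] c S_linearD(3)[OF g_lin, of c] e_in_S(1,6) by auto
  obtain Q where Q: "S_linear Q" "\<And>v. Q (U v) = v" "\<And>v. U (Q v) = v"
    using S_linear_inverse[OF U(1)] by metis
  \<comment> \<open>Now both swapped pairs are in standard position.\<close>
  have "U \<circ> g \<circ> Q = swap_x1_e1"
  proof (rule S_involution_canonical)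
    show "S_involution (U \<circ> g \<circ> Q)"
      by (rule S_involution_conjugate[OF g U(1) Q])
    show "(U \<circ> g \<circ> Q) x1 \<in> pm e1"
      by (rule conjugate_pm[OF g_lin U(1) Q(1,2) g_x1 U(2,3)])
    show "(U \<circ> g \<circ> Q) e2 \<in> pm e3"
      by (rule conjugate_pm[OF g_lin U(1) Q(1,2) _ U(4,5)]) simp
  qed
  then have "f \<circ> (R \<circ> Q) = (R \<circ> Q) \<circ> swap_x1_e1"
    by (simp add: fun_eq_iff g_def R(2) Q(2) flip: \<open>U \<circ> g \<circ> Q = swap_x1_e1\<close>)
  then show thesis
    using that S_linear_comp[OF R(1) Q(1)] by metis
qed

lemma conjugate_swap_x1_e1:
  assumes f: "f \<in> Aut" "f \<noteq> id" "f \<circ> f = id" "interchanges_only_nonadjacent BLS_adj f"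
  shows "conjugate_in (aut_group BLS_adj) swap_x1_e1 f"
proof -
  obtain w where w: "f w = w" using involution_fixpoint[OF f(3)] by blast
  have ff: "f (f u) = u" for u using f(3) by (metis comp_apply id_apply)
  obtain g where g: "S_linear g" and g_eq: "\<And>v. f (v + w) = g v + w"
    using Aut_fixpoint_affine[OF f(1) w] by metis
  have f_eq: "f v = g (v - w) + w" for v using g_eq[of "v - w"] by simp
  have "g (g v) = v" for v
    using ff[of "v + w"] by (simp add: g_eq)
  then have "g \<circ> g = id" by (simp add: fun_eq_iff)
  moreover have "g \<noteq> id"
  proof
    assume "g = id"
    then have "f = id" by (simp add: fun_eq_iff f_eq)
    then show False using f(2) by simp
  qed
  moreover have "g x \<noteq> - x" if "x \<in> S" for x
  proof
    assume "g x = - x"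
    then have fx: "f (x + w) = - x + w" by (simp add: g_eq)
    have "x \<noteq> - x"
      using double_F3_vec(1)[of x] that zero_notin_BLS_connection_set by (metis diff_self)
    then have "f (x + w) \<noteq> x + w"
      unfolding fx by (metis add_right_cancel)
    then have "\<not> BLS_adj (x + w) (f (x + w))"
      using f(4) unfolding interchanges_only_nonadjacent_def by metis
    moreover have "(x + w) - f (x + w) = x + x"
      unfolding fx by simp
    then have "(x + w) - f (x + w) = - x"
      unfolding double_F3_vec .
    ultimately show False using that by (simp add: BLS_adj_iff)
  qed
  ultimately have "S_involution g" using g by (simp add: S_involution_def)
  then obtain R where R: "S_linear R" "g \<circ> R = R \<circ> swap_x1_e1"
    by (rule S_involution_conj_swap_x1_e1)
  \<comment> \<open>The conjugator is affine: \<open>R\<close> matches the linear parts, and the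
    translation takes 0 to the fixed point \<open>w\<close>.\<close>
  show ?thesis
  proof (rule conjugateI)
    show "swap_x1_e1 \<in> Aut" by (rule S_linear_Aut) (rule S_linear_generators)
    show "f \<in> Aut" by fact
    show "(\<lambda>v. v + w) \<circ> R \<in> Aut" by (intro comp_Aut translation_Aut S_linear_Aut R)
    show "(\<lambda>v. v + w) \<circ> R \<circ> swap_x1_e1 = f \<circ> ((\<lambda>v. v + w) \<circ> R)"
      using R(2) by (simp add: fun_eq_iff f_eq)
  qed
qed

text \<open>The involution negates \<open>u - swap_x1_e1 u\<close>, but negates no element of the
  connection set.\<close>

lemma swap_x1_e1_nonadjacent: "interchanges_only_nonadjacent BLS_adj swap_x1_e1"
  unfolding interchanges_only_nonadjacent_def BLS_adj_iff
proof (intro allI impI notI)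
  fix u
  note s = S_involution_swap_x1_e1[unfolded S_involution_def]
  have "swap_x1_e1 (u - swap_x1_e1 u) = swap_x1_e1 u - swap_x1_e1 (swap_x1_e1 u)"
    using s additive.diff[OF S_linearD(1)] by blast
  also have "\<dots> = - (u - swap_x1_e1 u)"
    using s by (simp add: fun_eq_iff)
  finally show "u - swap_x1_e1 u \<in> S \<Longrightarrow> False"
    using s by blast
qed

theorem theorem1:
  "\<not> (\<exists>\<phi>\<in>carrier (aut_group BLS_adj).
          group.ord (aut_group BLS_adj) \<phi> = 2 \<and> interchanges_only_adjacent BLS_adj \<phi>)
   \<and> (\<exists>\<phi>\<in>carrier (aut_group BLS_adj).
          group.ord (aut_group BLS_adj) \<phi> = 2 \<and> interchanges_only_nonadjacent BLS_adj \<phi> \<and>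
          (\<forall>\<psi>\<in>carrier (aut_group BLS_adj).
             group.ord (aut_group BLS_adj) \<psi> = 2 \<and> interchanges_only_nonadjacent BLS_adj \<psi>
             \<longrightarrow> conjugate_in (aut_group BLS_adj) \<phi> \<psi>))"
proof (intro conjI)
  show "\<not> (\<exists>\<phi>\<in>Aut. group.ord (aut_group BLS_adj) \<phi> = 2 \<and> interchanges_only_adjacent BLS_adj \<phi>)"
    using not_interchanges_only_adjacent by (auto simp: ord_2_iff)
  have "swap_x1_e1 \<in> Aut" by (rule S_linear_Aut) (rule S_linear_generators)
  then show "\<exists>\<phi>\<in>Aut. group.ord (aut_group BLS_adj) \<phi> = 2 \<and> interchanges_only_nonadjacent BLS_adj \<phi> \<and>
      (\<forall>\<psi>\<in>Aut. group.ord (aut_group BLS_adj) \<psi> = 2 \<and> interchanges_only_nonadjacent BLS_adj \<psi>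
        \<longrightarrow> conjugate_in (aut_group BLS_adj) \<phi> \<psi>)"
    using S_involution_swap_x1_e1 swap_x1_e1_nonadjacent conjugate_swap_x1_e1
    by (intro bexI[of _ swap_x1_e1]) (simp_all add: ord_2_iff S_involution_def)
qed

end
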